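(* Let $(X_1,d_1),\dots,(X_N,d_N)$ be metric spaces whose metrics $d_i$ take values in $[0,1)$, and let $a_1,\dots,a_N$ be real numbers with $a_i\ge 1$ for all $i$. For $\mathbf{x}=(x_1,\dots,x_N),\mathbf{y}=(y_1,\dots,y_N)\in X_1\times\cdots\times X_N$ define $$d_{a_1,\dots,a_N}(\mathbf{x},\mathbf{y}) := 1-\prod_{i=1}^N\left(1-d_i(x_i,y_i)\right)^{a_i}.$$ Then $d_{a_1,\dots,a_N}$ is a metric on $X_1\times\cdots\times X_N$ taking values in $[0,1)$. *)

theory Defs
  imports "HOL-Analysis.Abstract_Metric_Spaces"
begin

text \<open>
  Points of \<open>X\<^sub>1 \<times> \<dots> \<times> X\<^sub>N\<close> are the elements of the extensional product \<open>\<Pi>\<^sub>E i\<in>{1..N}. X i\<close>.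
  The locale \<^locale>\<open>Metric_space\<close> demands nonnegativity and symmetry also off the carrier, where
  the factors \<open>1 - d i (x i) (y i)\<close> are unconstrained; hence the value \<open>0\<close> there. On the
  carrier all bases are positive, so \<open>powr\<close> is the ordinary real power.
\<close>

definition prod_powr_dist ::
    "nat \<Rightarrow> (nat \<Rightarrow> 'a set) \<Rightarrow> (nat \<Rightarrow> 'a \<Rightarrow> 'a \<Rightarrow> real) \<Rightarrow> (nat \<Rightarrow> real)
      \<Rightarrow> (nat \<Rightarrow> 'a) \<Rightarrow> (nat \<Rightarrow> 'a) \<Rightarrow> real" where
  "prod_powr_dist N X d a x y =
     (if x \<in> (\<Pi>\<^sub>E i\<in>{1..N}. X i) \<and> y \<in> (\<Pi>\<^sub>E i\<in>{1..N}. X i)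
      then 1 - (\<Prod>i=1..N. (1 - d i (x i) (y i)) powr a i)
      else 0)"

end

theory Submission
  imports Defs
begin

text \<open>
  In terms of the similarities \<open>p = 1 - d(x,y)\<close>, \<open>q = 1 - d(y,z)\<close>, \<open>r = 1 - d(x,z)\<close> in \<open>(0,1]\<close> the
  triangle inequality reads \<open>p + q \<le> 1 + r\<close>. This relation is stable under powers with exponent
  \<open>\<ge> 1\<close>, by convexity, and under componentwise products.
\<close>

lemma powr_add_le_one_plus:
  fixes p q r a :: real
  assumes p: "0 < p" "p \<le> 1" and q: "0 < q" "q \<le> 1" and r: "0 < r"
    and pqr: "p + q \<le> 1 + r" and a: "1 \<le> a"
  shows "p powr a + q powr a \<le> 1 + r powr a"
proof (cases "p + q \<le> 1")
  case True
  have "p powr a \<le> p powr 1" "q powr a \<le> q powr 1"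
    using p q a by (intro powr_mono'; simp)+
  then show ?thesis
    using True p q powr_ge_zero[of r a] by (simp del: powr_ge_zero)
next
  case False
  \<comment> \<open>\<open>s\<close> is the least value of \<open>r\<close> that \<open>pqr\<close>
    allows; by monotonicity of the power it suffices to treat this extremal case, where
    \<open>p + q = s + 1\<close>.\<close>
  define s where "s = p + q - 1"
  have s: "0 < s" "s \<le> r" using False pqr by (auto simp: s_def)
  have "p powr a + q powr a \<le> 1 + s powr a"
  \<comment> \<open>The weight \<open>t\<close> below divides by \<open>1 - s\<close>, so
    \<open>s = 1\<close> is split off.\<close>
  proof (cases "s = 1")
    case True
    then have "p = 1" "q = 1" using p q by (auto simp: s_def)
    then show ?thesis using True by simp
  next
    case False
    then have s1: "s < 1" using p q by (auto simp: s_def)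
    \<comment> \<open>\<open>p\<close> and \<open>q\<close> lie symmetrically between \<open>s\<close> and \<open>1\<close>.\<close>
    define t where "t = (p - s) / (1 - s)"
    have t: "0 \<le> t" "t \<le> 1"
      using s1 p q by (auto simp: t_def s_def field_simps)
    have "t * (1 - s) = p - s" using s1 by (simp add: t_def)
    then have pt: "p = (1 - t) * s + t * 1" and qt: "q = t * s + (1 - t) * 1"
      by (auto simp: s_def algebra_simps)
    \<comment> \<open>The two convexity bounds carry swapped weights, so \<open>t\<close> cancels in
      their sum.\<close>
    have "p powr a \<le> (1 - t) * s powr a + t * 1 powr a"
      using convex_onD[OF powr_convex[OF a], of t s 1] t s by (simp add: pt)
    moreover have "q powr a \<le> t * s powr a + (1 - t) * 1 powr a"
      using convex_onD[OF powr_convex[OF a], of "1 - t" s 1] t s by (simp add: qt)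
    ultimately show ?thesis by (simp add: algebra_simps)
  qed
  also have "s powr a \<le> r powr a"
    using s a by (intro powr_mono2) auto
  finally show ?thesis by simp
qed

text \<open>If one of the sums \<open>p + q\<close>, \<open>p' + q'\<close> is at most 1,
  multiplying its terms by numbers in the unit interval keeps it so. Otherwise \<open>r\<close> and
  \<open>r'\<close> may be lowered to the positive numbers \<open>p + q - 1\<close> and
  \<open>p' + q' - 1\<close>.\<close>

lemma mult_add_le_one_plus:
  fixes p q r p' q' r' :: real
  assumes "p \<in> {0..1}" "q \<in> {0..1}" "0 \<le> r" "p + q \<le> 1 + r"
    and "p' \<in> {0..1}" "q' \<in> {0..1}" "0 \<le> r'" "p' + q' \<le> 1 + r'"
  shows "p * p' + q * q' \<le> 1 + r * r'"
proof -
  have rr: "0 \<le> r * r'" using assms by simp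
  consider "p + q \<le> 1" | "p' + q' \<le> 1" | "p + q > 1" "p' + q' > 1" by linarith
  then show ?thesis
  proof cases
    case 1
    have "p * p' \<le> p" "q * q' \<le> q"
      using assms by (auto intro: mult_left_le)
    then show ?thesis using 1 rr by linarith
  next
    case 2
    have "p * p' \<le> p'" "q * q' \<le> q'"
      using assms by (auto intro: mult_left_le_one_le)
    then show ?thesis using 2 rr by linarith
  next
    case 3
    \<comment> \<open>The sum of these two products is exactly the right side minus the left side of
      the next inequality.\<close>
    have "0 \<le> (1 - p) * (1 - q')" "0 \<le> (1 - q) * (1 - p')"
      using assms by auto
    then have "p * p' + q * q' \<le> 1 + (p + q - 1) * (p' + q' - 1)"
      by (simp add: algebra_simps)
    also have "(p + q - 1) * (p' + q' - 1) \<le> r * r'"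
      using 3 assms by (intro mult_mono) auto
    finally show ?thesis by simp
  qed
qed

lemma prod_add_le_one_plus:
  fixes p q r :: "'i \<Rightarrow> real"
  assumes "finite I"
    and "\<And>i. i \<in> I \<Longrightarrow> p i \<in> {0..1}" "\<And>i. i \<in> I \<Longrightarrow> q i \<in> {0..1}" "\<And>i. i \<in> I \<Longrightarrow> 0 \<le> r i"
    and "\<And>i. i \<in> I \<Longrightarrow> p i + q i \<le> 1 + r i"
  shows "prod p I + prod q I \<le> 1 + prod r I"
  using assms
proof (induction I rule: finite_induct)
  case (insert i I)
  have "p i * prod p I + q i * prod q I \<le> 1 + r i * prod r I"
    using insert by (intro mult_add_le_one_plus) (auto intro!: prod_nonneg prod_le_1)
  then show ?case using insert by simp
qed simp

text \<open>The product is bounded by each of its factors, as the remaining ones multiply to at most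
  1. This serves to separate points.\<close>

lemma prod_eq_1_iff_unit_interval:
  fixes f :: "'i \<Rightarrow> real"
  assumes "finite I" and "\<And>i. i \<in> I \<Longrightarrow> f i \<in> {0..1}"
  shows "prod f I = 1 \<longleftrightarrow> (\<forall>i\<in>I. f i = 1)"
proof
  assume 1: "prod f I = 1"
  show "\<forall>i\<in>I. f i = 1"
  proof
    fix i assume i: "i \<in> I"
    have "prod f I = f i * prod f (I - {i})"
      using assms(1) i by (rule prod.remove)
    also have "\<dots> \<le> f i"
      using assms i by (intro mult_left_le prod_le_1) auto
    finally show "f i = 1" using 1 assms(2)[OF i] by simp
  qed
qed simp

theorem theorem1:
  fixes N :: nat
    and X :: "nat \<Rightarrow> 'a set"
    and d :: "nat \<Rightarrow> 'a \<Rightarrow> 'a \<Rightarrow> real"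
    and a :: "nat \<Rightarrow> real"
  assumes "\<And>i. i \<in> {1..N} \<Longrightarrow> Metric_space (X i) (d i)"
    and "\<And>i x y. i \<in> {1..N} \<Longrightarrow> x \<in> X i \<Longrightarrow> y \<in> X i \<Longrightarrow> d i x y \<in> {0..<1}"
    and "\<And>i. i \<in> {1..N} \<Longrightarrow> a i \<ge> 1"
  shows "Metric_space (\<Pi>\<^sub>E i\<in>{1..N}. X i) (prod_powr_dist N X d a) \<and>
    (\<forall>x \<in> (\<Pi>\<^sub>E i\<in>{1..N}. X i). \<forall>y \<in> (\<Pi>\<^sub>E i\<in>{1..N}. X i).
       prod_powr_dist N X d a x y \<in> {0..<1})"
proof -
  let ?P = "\<Pi>\<^sub>E i\<in>{1..N}. X i"
  let ?D = "prod_powr_dist N X d a"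
  define f where "f x y i = (1 - d i (x i) (y i)) powr a i" for x y i
  have D: "?D x y = 1 - prod (f x y) {1..N}" if "x \<in> ?P" "y \<in> ?P" for x y
    using that by (simp add: prod_powr_dist_def f_def)
  have dist: "0 \<le> d i (x i) (y i)" "d i (x i) (y i) < 1"
    if "x \<in> ?P" "y \<in> ?P" "i \<in> {1..N}" for x y i
    using assms(2)[OF that(3), of "x i" "y i"] that by (auto simp: PiE_iff)
  have f: "0 < f x y i" "f x y i \<le> 1" if "x \<in> ?P" "y \<in> ?P" "i \<in> {1..N}" for x y i
    using dist[OF that] assms(3)[OF that(3)] by (auto simp: f_def intro: powr_le1)
  have f_eq_1: "f x y i = 1 \<longleftrightarrow> x i = y i" if xy: "x \<in> ?P" "y \<in> ?P" "i \<in> {1..N}" for x y i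
  proof -
    \<comment> \<open>The base is positive and the exponent nonzero, so the power equals 1 only for
      base 1.\<close>
    have "f x y i = 1 \<longleftrightarrow> d i (x i) (y i) = 0"
      using dist[OF xy] assms(3)[OF xy(3)] powr_eq_one_iff_gen[of "1 - d i (x i) (y i)" "a i"]
      by (cases "d i (x i) (y i) = 0") (simp_all add: f_def del: powr_eq_one_iff_gen)
    also have "\<dots> \<longleftrightarrow> x i = y i"
      using Metric_space.zero[OF assms(1)[OF xy(3)]] xy by (auto simp: PiE_iff)
    finally show ?thesis .
  qed
  have range: "?D x y \<in> {0..<1}" if "x \<in> ?P" "y \<in> ?P" for x y
  proof -
    have "0 < prod (f x y) {1..N}" "prod (f x y) {1..N} \<le> 1"
      using f[OF that] by (auto intro!: prod_pos prod_le_1 simp: less_imp_le)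
    then show ?thesis by (simp add: D[OF that])
  qed
  have "Metric_space ?P ?D"
  proof
    fix x y
    show "0 \<le> ?D x y"
    proof (cases "x \<in> ?P \<and> y \<in> ?P")
      case True
      then show ?thesis using range[of x y] by simp
    next
      case False
      then show ?thesis unfolding prod_powr_dist_def by argo
    qed
    \<comment> \<open>\<open>Metric_space.commute\<close> holds off the carrier too, so no
      membership of \<open>x\<close> and \<open>y\<close> is required.\<close>
    have "(\<Prod>i=1..N. (1 - d i (x i) (y i)) powr a i) = (\<Prod>i=1..N. (1 - d i (y i) (x i)) powr a i)"
      using Metric_space.commute[OF assms(1)] by (intro prod.cong) auto
    then show "?D x y = ?D y x"
      unfolding prod_powr_dist_def by argo
  next
    fix x y assume xy: "x \<in> ?P" "y \<in> ?P"
    have "?D x y = 0 \<longleftrightarrow> prod (f x y) {1..N} = 1"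
      using D[OF xy] by auto
    also have "\<dots> \<longleftrightarrow> (\<forall>i\<in>{1..N}. f x y i = 1)"
      using f[OF xy] by (intro prod_eq_1_iff_unit_interval) (auto simp: less_imp_le)
    also have "\<dots> \<longleftrightarrow> (\<forall>i\<in>{1..N}. x i = y i)"
      using f_eq_1[OF xy] by blast
    \<comment> \<open>Members of the extensional product agree outside \<open>{1..N}\<close>, so
      equal coordinates give equal functions.\<close>
    also have "\<dots> \<longleftrightarrow> x = y"
      using PiE_ext[OF xy] by blast
    finally show "?D x y = 0 \<longleftrightarrow> x = y" .
  next
    fix x y z assume xyz: "x \<in> ?P" "y \<in> ?P" "z \<in> ?P"
    have "f x y i + f y z i \<le> 1 + f x z i" if i: "i \<in> {1..N}" for i
    proof -
      have "d i (x i) (z i) \<le> d i (x i) (y i) + d i (y i) (z i)"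
        using Metric_space.triangle[OF assms(1)[OF i]] xyz i by (auto simp: PiE_iff)
      \<comment> \<open>With each distance written as 1 minus a similarity, the triangle inequality
        in \<open>X i\<close> is the hypothesis \<open>p + q \<le> 1 + r\<close>; distances below 1
        make the similarities positive.\<close>
      then show ?thesis
        unfolding f_def
        using dist[OF xyz(1,2) i] dist[OF xyz(2,3) i] dist[OF xyz(1,3) i] assms(3)[OF i]
        by (intro powr_add_le_one_plus) auto
    qed
    then have "prod (f x y) {1..N} + prod (f y z) {1..N} \<le> 1 + prod (f x z) {1..N}"
      using f xyz by (intro prod_add_le_one_plus) (auto simp: less_imp_le)
    then show "?D x z \<le> ?D x y + ?D y z"
      using xyz by (simp add: D)
  qed
  then show ?thesis using range by blast
qed

end
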